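(* Let $0 \le \alpha < 1$, let $g \in \Sigma^*(\alpha)$, and let the inverse function of $g$ have the series expansion $$g^{-1}(w) = w + \sum_{n=0}^{\infty} B_n w^{-n}$$ in some neighbourhood of infinity. Then: (a) $|B_0| \le 2(1-\alpha)$ for all $0 \le \alpha < 1$; (b) for every integer $n \ge 1$, if $\alpha \in I_k(n)$ for some $k \in \{0,\dots,n-2\}$, then $$|B_n| \le \frac{\Gamma(2n(1-\alpha)+1)}{n(n+1)\,\Gamma(n-k)\,\Gamma(2n(1-\alpha)+1-(n-k))};$$ (c) for every integer $n \ge 1$, if $\alpha \in I_{n-1}(n)$, then $$|B_n| \le \frac{2(1-\alpha)}{n+1}.$$ The estimates in (a) and (c) are sharp: for every $\alpha \in [0,1)$ there is $g \in \Sigma^*(\alpha)$ for which equality holds in (a), and for every $n \ge 1$ and $\alpha \in I_{n-1}(n)$ there is $g \in \Sigma^*(\alpha)$ for which equality holds in (c).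
   Context: Let $V = \{z \in \mathbb{C} : 1 < |z| < \infty\}$. $\Sigma$ is the class of functions $g$ analytic and univalent in $V$ having a Laurent expansion of the form $g(z) = z + b_0 + \frac{b_1}{z} + \frac{b_2}{z^2} + \cdots$ in $V$. For $0 \le \alpha < 1$, $\Sigma^*(\alpha)$ (starlike functions of order $\alpha$ in $V$) is the class of $g \in \Sigma$ satisfying $\operatorname{Re}\left(\frac{z g'(z)}{g(z)}\right) > \alpha$ for all $z \in V$ (in particular $g$ has no zeros in $V$). $g^{-1}$ denotes the inverse function of $g$, defined and analytic in a punctured neighbourhood of infinity. For an integer $n \ge 1$ and $k = 0,1,\dots,n-1$, $I_k(n)$ denotes the half-open interval $\left[\frac{k}{n}, \frac{k+1}{n}\right)$. $\Gamma$ is the Gamma function. *)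

theory Defs
  imports "HOL-Complex_Analysis.Complex_Analysis"
begin

definition ext_disc :: "complex set" where
  "ext_disc = {z. 1 < norm z}"

definition Sigma_class :: "(complex \<Rightarrow> complex) set" where
  "Sigma_class = {g. g analytic_on ext_disc \<and> inj_on g ext_disc \<and>
     (\<exists>b :: nat \<Rightarrow> complex. \<forall>z\<in>ext_disc. (\<lambda>n. b n / z ^ n) sums (g z - z))}"

text \<open>The nonvanishing condition is stated explicitly because division by zero is total in HOL.\<close>

definition Sigma_star :: "real \<Rightarrow> (complex \<Rightarrow> complex) set" where
  "Sigma_star \<alpha> = {g \<in> Sigma_class.
     \<forall>z\<in>ext_disc. g z \<noteq> 0 \<and> Re (z * deriv g z / g z) > \<alpha>}"

text \<open>
  The inverse of \<open>g\<close> restricted to the exterior disc is defined near infinity, and there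
  \<open>g\<^sup>-\<^sup>1(w) = w + B\<^sub>0 + B\<^sub>1 / w + B\<^sub>2 / w\<^sup>2 + \<dots>\<close>.
  Membership of \<open>w\<close> in the image ensures that \<open>inv_into\<close> is the actual inverse at \<open>w\<close>.
\<close>

definition inverse_expansion :: "(complex \<Rightarrow> complex) \<Rightarrow> (nat \<Rightarrow> complex) \<Rightarrow> bool" where
  "inverse_expansion g B \<longleftrightarrow>
     (\<forall>\<^sub>F w in at_infinity. w \<in> g ` ext_disc \<and>
        (\<lambda>n. B n / w ^ n) sums (inv_into ext_disc g w - w))"

definition subinterval :: "nat \<Rightarrow> nat \<Rightarrow> real set" where
  "subinterval k n = {real k / real n ..< real (k + 1) / real n}"

end

theory Submission
  imports Defs
begin

text \<open>
  Put \<open>h(z) = z g(1/z)\<close> on the unit disc. The condition on \<open>g\<close> says \<open>Re (z h'/h) < 1 - \<alpha>\<close>, so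
  \<open>z h' = \<omega> (z h' - 2(1 - \<alpha>) h)\<close> for some analytic \<open>\<omega>\<close> with \<open>\<bar>\<omega>\<bar> \<le> 1\<close> and \<open>\<omega>(0) = 0\<close>. The
  power \<open>h\<^sup>n = \<Sum> a\<^sub>j z\<^sup>j\<close> satisfies the same equation with \<open>\<beta> = 2n(1 - \<alpha>)\<close> in place of
  \<open>2(1 - \<alpha>)\<close>, and Clunie's method yields
  \<open>m\<^sup>2 \<bar>a\<^sub>m\<bar>\<^sup>2 \<le> \<Sum>j<m. \<beta> (\<beta> - 2j) \<bar>a\<^sub>j\<bar>\<^sup>2\<close>.
  By induction \<open>\<bar>a\<^sub>j\<bar> \<le> (\<beta> choose j)\<close> as long as \<open>2(j - 1) \<le> \<beta>\<close>; for \<open>m = n + 1\<close> the terms with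
  \<open>2j \<ge> \<beta>\<close>, i.e. \<open>j \<ge> n - k\<close>, are dropped and the remaining sum with binomial coefficients
  telescopes. Lagrange inversion gives \<open>B\<^sub>n = - a\<^sub>n\<^sub>+\<^sub>1 / n\<close>. Equality holds for
  \<open>\<omega>(z) = z\<^sup>n\<^sup>+\<^sup>1\<close>, that is \<open>g(z) = z (1 - z\<^sup>-\<^sup>n\<^sup>-\<^sup>1) powr (2(1 - \<alpha>)/(n + 1))\<close>.
\<close>

subsection \<open>Clunie's method\<close>

text \<open>Parseval's identity for the discrete Fourier transform: expand the square and use
  orthogonality of characters. The bound \<open>L \<le> N\<close> makes distinct exponents below
  \<open>L\<close> give distinct roots, so the off-diagonal sums vanish.\<close>

lemma sum_norm_square_roots_unity:
  fixes p :: "nat \<Rightarrow> complex"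
  assumes "L \<le> N" "N > 0"
  shows "(\<Sum>j<N. (norm (\<Sum>k<L. p k * cis (2 * pi * real j / real N) ^ k))\<^sup>2)
           = real N * (\<Sum>k<L. (norm (p k))\<^sup>2)"
proof -
  define \<xi> where "\<xi> = (\<lambda>j. cis (2 * pi * real j / real N))"
  \<comment> \<open>Only the product of the two indices matters; exchanging them turns the sum over
    \<open>j\<close> into a geometric sum.\<close>
  have swap: "\<xi> j ^ k = \<xi> k ^ j" for j k
    unfolding \<xi>_def Complex.DeMoivre by (rule arg_cong[of _ _ cis]) simp
  have cancel: "\<xi> k * cnj (\<xi> k) = 1" for k
    unfolding complex_norm_square[symmetric] \<xi>_def by simp
  have orth: "(\<Sum>j<N. \<xi> j ^ k * cnj (\<xi> j ^ l)) = (if k = l then of_nat N else 0)"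
    if "k < L" "l < L" for k l
  proof -
    have eq: "(\<Sum>j<N. \<xi> j ^ k * cnj (\<xi> j ^ l)) = (\<Sum>j<N. (\<xi> k * cnj (\<xi> l)) ^ j)"
      by (subst (1 2) swap) (simp add: power_mult_distrib)
    show ?thesis
    proof (cases "k = l")
      case True
      then show ?thesis unfolding eq by (simp add: cancel)
    next
      case False
      have "\<xi> k \<noteq> \<xi> l"
        using Complex.bij_betw_roots_unity[OF assms(2)] that False assms(1)
        unfolding bij_betw_def inj_on_def \<xi>_def by (metis lessThan_iff less_le_trans)
      then have ne: "\<xi> k * cnj (\<xi> l) \<noteq> 1"
        using cancel[of l] by (metis mult.commute mult.right_neutral mult.assoc)
      have "\<xi> k ^ N = 1" for k
        using assms(2) by (simp add: \<xi>_def Complex.DeMoivre cis_multiple_2pi)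
      then have "(\<xi> k * cnj (\<xi> l)) ^ N = 1"
        by (simp add: power_mult_distrib flip: complex_cnj_power)
      with ne False show ?thesis
        unfolding eq by (simp add: geometric_sum)
    qed
  qed
  have "complex_of_real (\<Sum>j<N. (norm (\<Sum>k<L. p k * \<xi> j ^ k))\<^sup>2)
      = (\<Sum>j<N. \<Sum>k<L. \<Sum>l<L. p k * cnj (p l) * (\<xi> j ^ k * cnj (\<xi> j ^ l)))"
    unfolding of_real_sum complex_norm_square cnj_sum sum_product
    by (simp add: mult_ac del: complex_cnj_power)
  also have "\<dots> = (\<Sum>k<L. \<Sum>j<N. \<Sum>l<L. p k * cnj (p l) * (\<xi> j ^ k * cnj (\<xi> j ^ l)))"
    by (rule sum.swap)
  also have "\<dots> = (\<Sum>k<L. \<Sum>l<L. \<Sum>j<N. p k * cnj (p l) * (\<xi> j ^ k * cnj (\<xi> j ^ l)))"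
    by (rule sum.cong[OF refl], rule sum.swap)
  also have "\<dots> = (\<Sum>k<L. \<Sum>l<L. p k * cnj (p l) * (if k = l then of_nat N else 0))"
    by (intro sum.cong refl) (simp add: orth del: complex_cnj_power flip: sum_distrib_left)
  also have "\<dots> = complex_of_real (real N * (\<Sum>k<L. (norm (p k))\<^sup>2))"
    unfolding of_real_mult of_real_sum complex_norm_square
    by (simp add: sum.delta sum_distrib_left mult_ac if_distrib cong: if_cong)
  finally show ?thesis
    unfolding \<xi>_def of_real_eq_iff .
qed

text \<open>
  Discrete averages over \<open>N\<close>-th roots of unity replace integrals over the circle: they are exact
  for polynomials of degree below \<open>N\<close>, so it suffices to truncate \<open>f\<close> up to a small tail \<open>e L\<close>.
\<close>

lemma sum_norm_square_mono_circle:
  fixes f q :: "nat \<Rightarrow> complex"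
  assumes summ: "summable (\<lambda>k. norm (f k))"
  and le: "\<And>z. norm z = 1 \<Longrightarrow> norm (\<Sum>k. f k * z ^ k) \<le> norm (\<Sum>k<m. q k * z ^ k)"
  shows "(\<Sum>k<M. (norm (f k))\<^sup>2) \<le> (\<Sum>k<m. (norm (q k))\<^sup>2)"
proof -
  define e where "e = (\<lambda>L. (\<Sum>k. norm (f k)) - (\<Sum>k<L. norm (f k)))"
  define C where "C = (\<Sum>k<m. norm (q k))"
  have e0: "e \<longlonglongrightarrow> 0"
    unfolding e_def using tendsto_diff[OF tendsto_const[of "\<Sum>k. norm (f k)"] summable_LIMSEQ[OF summ]] by simp
  have e_nonneg: "e L \<ge> 0" for L
    unfolding e_def using sum_le_suminf[OF summ, of "{..<L}"] by simp
  have tail: "norm (\<Sum>k<L. f k * z ^ k) \<le> norm (\<Sum>k<m. q k * z ^ k) + e L" if z: "norm z = 1" for z L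
  proof -
    have s: "summable (\<lambda>k. norm (f k * z ^ k))"
      using summ z by (simp add: norm_mult norm_power)
    have "(\<Sum>k. f k * z ^ k) - (\<Sum>k<L. f k * z ^ k) = (\<Sum>k. f (k + L) * z ^ (k + L))"
      using suminf_minus_initial_segment[OF summable_norm_cancel[OF s]] by simp
    also have "norm \<dots> \<le> (\<Sum>k. norm (f (k + L) * z ^ (k + L)))"
      by (rule summable_norm) (use summable_ignore_initial_segment[OF s, of L] in simp)
    also have "\<dots> = e L"
      unfolding e_def using suminf_minus_initial_segment[OF summ, of L] z
      by (simp add: norm_mult norm_power)
    finally show ?thesis
      using le[OF z] norm_triangle_sub[of "\<Sum>k<L. f k * z ^ k" "\<Sum>k. f k * z ^ k"]
      by (simp add: norm_minus_commute)
  qed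
  have bound: "(\<Sum>k<L. (norm (f k))\<^sup>2) \<le> (\<Sum>k<m. (norm (q k))\<^sup>2) + e L * (2 * C + e L)" for L
  proof -
    \<comment> \<open>\<open>N\<close> exceeds both truncation degrees, so the discrete Parseval
      identity is exact for both polynomials at once.\<close>
    define N where "N = Suc (max L m)"
    have N: "L \<le> N" "m \<le> N" "N > 0" by (auto simp: N_def)
    define \<xi> where "\<xi> = (\<lambda>j. cis (2 * pi * real j / real N))"
    have n\<xi>: "norm (\<xi> j) = 1" for j by (simp add: \<xi>_def)
    have "real N * (\<Sum>k<L. (norm (f k))\<^sup>2) = (\<Sum>j<N. (norm (\<Sum>k<L. f k * \<xi> j ^ k))\<^sup>2)"
      unfolding \<xi>_def using N by (simp only: sum_norm_square_roots_unity)
    also have "\<dots> \<le> (\<Sum>j<N. (norm (\<Sum>k<m. q k * \<xi> j ^ k))\<^sup>2 + e L * (2 * C + e L))"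
    proof (rule sum_mono)
      fix j
      let ?Q = "norm (\<Sum>k<m. q k * \<xi> j ^ k)"
      have "?Q \<le> (\<Sum>k<m. norm (q k * \<xi> j ^ k))" by (rule norm_sum)
      also have "\<dots> = C" by (simp add: C_def norm_mult norm_power n\<xi>)
      finally have Q: "?Q \<le> C" .
      have "(norm (\<Sum>k<L. f k * \<xi> j ^ k))\<^sup>2 \<le> (?Q + e L)\<^sup>2"
        by (intro power_mono tail n\<xi>) auto
      also have "\<dots> = ?Q\<^sup>2 + e L * (2 * ?Q + e L)" by (simp add: power2_eq_square algebra_simps)
      also have "\<dots> \<le> ?Q\<^sup>2 + e L * (2 * C + e L)"
        using Q e_nonneg[of L] by (intro add_left_mono mult_left_mono) auto
      finally show "(norm (\<Sum>k<L. f k * \<xi> j ^ k))\<^sup>2 \<le> ?Q\<^sup>2 + e L * (2 * C + e L)" .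
    qed
    also have "\<dots> = real N * (\<Sum>k<m. (norm (q k))\<^sup>2) + real N * (e L * (2 * C + e L))"
      unfolding sum.distrib \<xi>_def using N by (simp only: sum_norm_square_roots_unity) simp
    finally show ?thesis
      using N(3) by (simp flip: distrib_left)
  qed
  show ?thesis
  \<comment> \<open>\<open>M\<close> stays fixed while \<open>L\<close> grows, and the error caused
    by the tail tends to 0.\<close>
  proof (rule LIMSEQ_le_const)
    show "(\<lambda>L. (\<Sum>k<m. (norm (q k))\<^sup>2) + e L * (2 * C + e L)) \<longlonglongrightarrow> (\<Sum>k<m. (norm (q k))\<^sup>2)"
      by (rule tendsto_eq_intros refl e0)+ simp
    have "(\<Sum>k<M. (norm (f k))\<^sup>2) \<le> (\<Sum>k<L. (norm (f k))\<^sup>2)" if "L \<ge> M" for L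
      using that by (intro sum_mono2) auto
    with bound show "\<exists>L0. \<forall>L\<ge>L0. (\<Sum>k<M. (norm (f k))\<^sup>2) \<le> (\<Sum>k<m. (norm (q k))\<^sup>2) + e L * (2 * C + e L)"
      by (meson order_trans)
  qed
qed

lemma eval_fps_cutoff: "eval_fps (fps_cutoff m Q) z = (\<Sum>k<m. fps_nth Q k * (z :: complex) ^ k)"
proof -
  have "eval_fps (fps_cutoff m Q) z = (\<Sum>k. if k \<in> {..<m} then fps_nth Q k * z ^ k else 0)"
    unfolding eval_fps_def by (intro suminf_cong) auto
  also have "\<dots> = (\<Sum>k<m. fps_nth Q k * z ^ k)"
    by (subst suminf_finite[of "{..<m}"]) auto
  finally show ?thesis .
qed

text \<open>Multiplication by \<open>\<omega>\<close> does not increase the modulus of a polynomial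
  at any point of the disc, hence not its mean square on circles; by Parseval this is a comparison
  of coefficients.\<close>

lemma clunie_inequality:
  fixes W Q :: "complex fps"
  assumes hol: "\<omega> holomorphic_on ball 0 1" and exp: "\<omega> has_fps_expansion W"
    and le: "\<And>z. norm z < 1 \<Longrightarrow> norm (\<omega> z) \<le> 1"
  shows "(\<Sum>k<M. (norm (fps_nth (W * fps_cutoff m Q) k))\<^sup>2) \<le> (\<Sum>k<m. (norm (fps_nth Q k))\<^sup>2)"
proof -
  define F where "F = W * fps_cutoff m Q"
  have conv_cut: "fps_conv_radius (fps_cutoff m Q) = \<infinity>"
    by (simp flip: fps_of_poly_truncate)
  have convW: "fps_conv_radius W \<ge> 1"
    using holomorphic_on_imp_fps_conv_radius_ge[OF exp, of 1] hol by (simp add: one_ereal_def)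
  have convF: "fps_conv_radius F \<ge> 1"
    unfolding F_def using fps_conv_radius_mult[of W "fps_cutoff m Q"] convW conv_cut
    by (simp add: min_def)
  have evalF: "eval_fps F z = \<omega> z * (\<Sum>k<m. fps_nth Q k * z ^ k)" if z: "norm z < 1" for z
  proof -
    have "ereal (norm z) < 1" using z by (simp add: one_ereal_def)
    then have "eval_fps F z = eval_fps W z * eval_fps (fps_cutoff m Q) z"
      unfolding F_def using order.strict_trans2[OF _ convW] conv_cut by (intro eval_fps_mult) auto
    also have "eval_fps W z = \<omega> z"
      by (rule has_fps_expansion_imp_eval_fps_eq[OF exp z hol])
    finally show ?thesis by (simp add: eval_fps_cutoff)
  qed
  \<comment> \<open>Nothing is known about \<open>\<omega>\<close> on the unit circle itself. The
    circle of radius \<open>r\<close> is used instead, with \<open>r ^ k\<close> absorbed into the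
    coefficients, and finally \<open>r\<close> tends to 1.\<close>
  have "(\<Sum>k<M. (norm (fps_nth F k * of_real r ^ k))\<^sup>2) \<le> (\<Sum>k<m. (norm (fps_nth Q k))\<^sup>2)"
    if r: "0 < r" "r < 1" for r :: real
  proof -
    have "(\<Sum>k<M. (norm (fps_nth F k * of_real r ^ k))\<^sup>2)
            \<le> (\<Sum>k<m. (norm (fps_nth Q k * of_real r ^ k))\<^sup>2)"
    proof (rule sum_norm_square_mono_circle)
      have "ereal (norm (of_real r :: complex)) < fps_conv_radius F"
        using r by (intro order.strict_trans2[OF _ convF]) (simp add: one_ereal_def)
      from norm_summable_fps[OF this]
      show "summable (\<lambda>k. norm (fps_nth F k * of_real r ^ k))" .
    next
      fix z :: complex assume z: "norm z = 1"
      have rz: "norm (of_real r * z) < 1" using z r by (simp add: norm_mult)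
      have "(\<Sum>k. fps_nth F k * of_real r ^ k * z ^ k) = eval_fps F (of_real r * z)"
        by (simp add: eval_fps_def power_mult_distrib mult.assoc)
      also have "\<dots> = \<omega> (of_real r * z) * (\<Sum>k<m. fps_nth Q k * of_real r ^ k * z ^ k)"
        unfolding evalF[OF rz] by (simp add: power_mult_distrib mult.assoc)
      finally show "norm (\<Sum>k. fps_nth F k * of_real r ^ k * z ^ k)
                  \<le> norm (\<Sum>k<m. fps_nth Q k * of_real r ^ k * z ^ k)"
        using le[OF rz] by (simp add: norm_mult mult_left_le_one_le)
    qed
    also have "\<dots> \<le> (\<Sum>k<m. (norm (fps_nth Q k))\<^sup>2)"
      using r by (intro sum_mono power_mono) (auto simp: norm_mult norm_power power_le_one mult_left_le)
    finally show ?thesis .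
  qed
  then have "\<forall>\<^sub>F r in at_left 1.
      (\<Sum>k<M. (norm (fps_nth F k * of_real r ^ k))\<^sup>2) \<le> (\<Sum>k<m. (norm (fps_nth Q k))\<^sup>2)"
    using eventually_at_left_real[of 0 1] by (auto elim!: eventually_mono)
  moreover have "((\<lambda>r. \<Sum>k<M. (norm (fps_nth F k * of_real r ^ k))\<^sup>2)
      \<longlongrightarrow> (\<Sum>k<M. (norm (fps_nth F k * of_real 1 ^ k))\<^sup>2)) (at_left 1)"
    by (intro tendsto_intros)
  ultimately show ?thesis
    using tendsto_upperbound[of _ _ "at_left (1::real)"] unfolding F_def by fastforce
qed

text \<open>Truncating \<open>Q\<close> below \<open>m\<close> still leaves the coefficients of the
  product correct up to order \<open>m\<close> inclusive, so the square of order \<open>m\<close>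
  survives on the left. The lower orders combine through
  \<open>(j - \<beta>)^2 - j^2 = \<beta> * (\<beta> - 2 * j)\<close>.\<close>

lemma clunie_coefficient_inequality:
  fixes W A :: "complex fps" and \<beta> :: real
  assumes "\<omega> holomorphic_on ball 0 1" "\<omega> has_fps_expansion W"
    and "\<And>z. norm z < 1 \<Longrightarrow> norm (\<omega> z) \<le> 1"
    and W0: "fps_nth W 0 = 0"
    and eq: "fps_X * fps_deriv A = W * (fps_X * fps_deriv A - fps_const (of_real \<beta>) * A)"
  shows "(real m * norm (fps_nth A m))\<^sup>2 \<le> (\<Sum>j<m. \<beta> * (\<beta> - 2 * real j) * (norm (fps_nth A j))\<^sup>2)"
proof -
  define Q where "Q = fps_X * fps_deriv A - fps_const (of_real \<beta>) * A"
  have XD: "fps_nth (fps_X * fps_deriv A) k = of_nat k * fps_nth A k" for k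
    by (cases k) simp_all
  have Q: "fps_nth Q k = of_real (real k - \<beta>) * fps_nth A k" for k
    by (simp only: Q_def fps_sub_nth XD fps_mult_left_const_nth) (simp add: algebra_simps)
  \<comment> \<open>Since \<open>W\<close> has no constant term, the coefficients of \<open>W * Q\<close> up to order \<open>m\<close> only see those
    of \<open>Q\<close> below \<open>m\<close>.\<close>
  have trunc: "fps_nth (W * fps_cutoff m Q) k = of_nat k * fps_nth A k" if "k \<le> m" for k
  proof -
    have "fps_nth (W * fps_cutoff m Q) k = fps_nth (W * Q) k"
      unfolding fps_mult_nth
    proof (rule sum.cong[OF refl])
      fix i assume "i \<in> {0..k}"
      then show "fps_nth W i * fps_nth (fps_cutoff m Q) (k - i) = fps_nth W i * fps_nth Q (k - i)"
        using that W0 by (cases "i = 0") auto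
    qed
    then show ?thesis
      using XD[of k] eq unfolding Q_def by simp
  qed
  have "(\<Sum>k<Suc m. (real k)\<^sup>2 * (norm (fps_nth A k))\<^sup>2)
      = (\<Sum>k<Suc m. (norm (fps_nth (W * fps_cutoff m Q) k))\<^sup>2)"
    by (intro sum.cong refl) (simp add: trunc norm_mult power_mult_distrib)
  also have "\<dots> \<le> (\<Sum>k<m. (norm (fps_nth Q k))\<^sup>2)"
    by (intro clunie_inequality[of \<omega>] assms)
  also have "\<dots> = (\<Sum>k<m. (real k - \<beta>)\<^sup>2 * (norm (fps_nth A k))\<^sup>2)"
    unfolding Q norm_mult norm_of_real power_mult_distrib power2_abs by (rule refl)
  finally have "(real m)\<^sup>2 * (norm (fps_nth A m))\<^sup>2
      \<le> (\<Sum>k<m. (real k - \<beta>)\<^sup>2 * (norm (fps_nth A k))\<^sup>2 - (real k)\<^sup>2 * (norm (fps_nth A k))\<^sup>2)"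
    by (simp add: sum_subtractf)
  also have "\<dots> = (\<Sum>j<m. \<beta> * (\<beta> - 2 * real j) * (norm (fps_nth A j))\<^sup>2)"
    by (intro sum.cong refl) (simp add: power2_eq_square algebra_simps)
  finally show ?thesis by (simp add: power_mult_distrib)
qed

section \<open>Binomial bounds from the Clunie inequality\<close>

text \<open>Binomial coefficients turn the Clunie inequality into an equality. The telescoping step
  is \<open>(\<beta> - m)^2 = m^2 + \<beta> * (\<beta> - 2 * m)\<close>.\<close>

lemma sum_gbinomial_square:
  fixes \<beta> :: real
  shows "(\<Sum>j<m. \<beta> * (\<beta> - 2 * real j) * (\<beta> gchoose j)\<^sup>2) = (real m * (\<beta> gchoose m))\<^sup>2"
proof (induction m)
  case (Suc m)
  have "real (Suc m) * (\<beta> gchoose Suc m) = (\<beta> - real m) * (\<beta> gchoose m)"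
    using gbinomial_mult_1[of \<beta> m] by (simp add: algebra_simps)
  then show ?case
    unfolding sum.lessThan_Suc Suc by (simp only: power2_eq_square) (simp add: algebra_simps)
qed simp

text \<open>The weights \<open>\<beta> - 2 * i\<close> are nonnegative before \<open>M\<close>,
  where moduli may be replaced by larger binomials, and nonpositive from \<open>M\<close> on, where
  terms may be dropped.\<close>

lemma coefficient_bound_from_clunie:
  fixes A :: "nat \<Rightarrow> complex" and \<beta> :: real
  assumes ineq: "\<And>m. (real m * norm (A m))\<^sup>2 \<le> (\<Sum>j<m. \<beta> * (\<beta> - 2 * real j) * (norm (A j))\<^sup>2)"
    and A0: "A 0 = 1" and \<beta>: "\<beta> \<ge> 0"
    and pos: "\<And>i. i < M \<Longrightarrow> 2 * real i \<le> \<beta>"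
    and neg: "\<And>i. M \<le> i \<Longrightarrow> i < m \<Longrightarrow> \<beta> \<le> 2 * real i"
    and "M \<le> m"
  shows "real m * norm (A m) \<le> real M * \<bar>\<beta> gchoose M\<bar>"
proof -
  \<comment> \<open>Strong induction on partial sums: the bound for the sum up to \<open>i\<close>
    controls \<open>A i\<close> through \<open>ineq\<close>, and these controls bound the sum up to
    \<open>j\<close>. Index 0 is separate, since there the factor \<open>i\<close> makes
    \<open>ineq\<close> vacuous.\<close>
  have partial: "(\<Sum>i<j. \<beta> * (\<beta> - 2 * real i) * (norm (A i))\<^sup>2) \<le> (real j * (\<beta> gchoose j))\<^sup>2"
    if "j \<le> M" for j
    using that
  proof (induction j rule: less_induct)
    case (less j)
    have small: "norm (A i) \<le> \<bar>\<beta> gchoose i\<bar>" if "i < j" for i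
    proof (cases "i = 0")
      case False
      have "(real i * norm (A i))\<^sup>2 \<le> (real i * (\<beta> gchoose i))\<^sup>2"
        using less.IH[of i] less.prems that ineq[of i] by linarith
      then have "real i * norm (A i) \<le> real i * \<bar>\<beta> gchoose i\<bar>"
        unfolding abs_le_square_iff[symmetric] by (simp add: abs_mult)
      then show ?thesis using False by simp
    qed (simp add: A0)
    have "(\<Sum>i<j. \<beta> * (\<beta> - 2 * real i) * (norm (A i))\<^sup>2)
        \<le> (\<Sum>i<j. \<beta> * (\<beta> - 2 * real i) * (\<beta> gchoose i)\<^sup>2)"
    proof (intro sum_mono mult_left_mono)
      fix i assume i: "i \<in> {..<j}"
      show "(norm (A i))\<^sup>2 \<le> (\<beta> gchoose i)\<^sup>2"
        using power_mono[OF small, of i 2] i by simp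
      show "0 \<le> \<beta> * (\<beta> - 2 * real i)"
        using pos[of i] i less.prems \<beta> by simp
    qed
    then show ?case by (simp add: sum_gbinomial_square)
  qed
  have "(real m * norm (A m))\<^sup>2 \<le> (\<Sum>j<m. \<beta> * (\<beta> - 2 * real j) * (norm (A j))\<^sup>2)"
    by (rule ineq)
  also have "\<dots> \<le> (\<Sum>j<M. \<beta> * (\<beta> - 2 * real j) * (norm (A j))\<^sup>2)"
  proof -
    have "(\<Sum>j\<in>{..<m} - {..<M}. \<beta> * (\<beta> - 2 * real j) * (norm (A j))\<^sup>2) \<le> 0"
      using neg \<beta> by (intro sum_nonpos) (auto simp: mult_nonneg_nonpos mult_nonpos_nonneg)
    then show ?thesis
      using sum.subset_diff[of "{..<M}" "{..<m}" "\<lambda>j. \<beta> * (\<beta> - 2 * real j) * (norm (A j))\<^sup>2"] \<open>M \<le> m\<close>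
      by auto
  qed
  also have "\<dots> \<le> (real M * (\<beta> gchoose M))\<^sup>2"
    by (rule partial) simp
  finally show ?thesis
    unfolding abs_le_square_iff[symmetric] by (simp add: abs_mult)
qed

subsection \<open>Lagrange inversion\<close>

lemma fps_mult_compose_nth:
  fixes C K \<phi> :: "'a :: field fps"
  assumes "fps_nth \<phi> 0 = 0"
  shows "fps_nth (C * (K oo \<phi>)) m = (\<Sum>j\<le>m. fps_nth K j * fps_nth (C * \<phi> ^ j) m)"
proof -
  have "fps_nth (C * (K oo \<phi>)) m
      = (\<Sum>i\<le>m. fps_nth C i * (\<Sum>j\<le>m - i. fps_nth K j * fps_nth (\<phi> ^ j) (m - i)))"
    by (simp add: fps_mult_nth fps_compose_nth atLeast0AtMost)
  \<comment> \<open>Powers of \<open>\<phi>\<close> beyond \<open>m - i\<close> have no coefficient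
    of that order, so the inner range can be made independent of \<open>i\<close> before the sums
    are exchanged.\<close>
  also have "\<dots> = (\<Sum>i\<le>m. fps_nth C i * (\<Sum>j\<le>m. fps_nth K j * fps_nth (\<phi> ^ j) (m - i)))"
    using assms
    by (intro sum.cong refl arg_cong2[of _ _ _ _ "(*)"] sum.mono_neutral_left)
       (auto simp: startsby_zero_power_prefix)
  also have "\<dots> = (\<Sum>j\<le>m. fps_nth K j * fps_nth (C * \<phi> ^ j) m)"
    by (simp add: fps_mult_nth sum_distrib_left atLeast0AtMost mult_ac)
       (rule sum.swap)
  finally show ?thesis .
qed

text \<open>The Euler operator \<open>X d/dX\<close> multiplies the coefficient of order
  \<open>q\<close> by \<open>q\<close>. The coefficient vanishes at \<open>q = Suc p\<close>, which
  is what isolates a single term in the Lagrange inversion.\<close>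

lemma fps_power_mult_euler_nth:
  fixes H :: "'a :: field_char_0 fps"
  shows "of_nat (Suc p) * fps_nth (H ^ p * (H - fps_X * fps_deriv H)) q
           = (of_nat (Suc p) - of_nat q) * fps_nth (H ^ Suc p) q"
proof -
  have "fps_const (of_nat (Suc p)) * (H ^ p * (H - fps_X * fps_deriv H))
      = fps_const (of_nat (Suc p)) * H ^ Suc p - fps_X * fps_deriv (H ^ Suc p)"
    unfolding fps_deriv_power by (simp add: algebra_simps)
  then have "fps_nth (fps_const (of_nat (Suc p)) * (H ^ p * (H - fps_X * fps_deriv H))) q
      = fps_nth (fps_const (of_nat (Suc p)) * H ^ Suc p - fps_X * fps_deriv (H ^ Suc p)) q"
    by (rule arg_cong)
  moreover have "fps_nth (fps_X * fps_deriv (H ^ Suc p)) q = of_nat q * fps_nth (H ^ Suc p) q"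
    by (cases q) (simp_all del: power_Suc)
  ultimately show ?thesis
    by (simp only: fps_mult_left_const_nth fps_sub_nth) (simp add: algebra_simps)
qed

text \<open>
  The hypothesis says that \<open>X / K\<close> is the compositional inverse of \<open>\<phi> = X / H\<close>. Multiplying
  \<open>K oo \<phi>\<close> by \<open>H ^ n * D\<close> with \<open>D = H - X * H'\<close> kills the contribution of every
  \<open>\<phi> ^ j\<close>, \<open>j \<le> n\<close>, to the coefficient of order \<open>n + 1\<close>: it becomes the coefficient of
  order \<open>i = n + 1 - j\<close> of \<open>H ^ i - X * (H ^ i)' / i\<close>.
\<close>

lemma fps_lagrange_reciprocal:
  fixes H K :: "'a :: field_char_0 fps"
  assumes H0: "fps_nth H 0 = 1"
    and eq: "H * (K oo (fps_X * inverse H)) = 1"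
    and n: "n \<ge> 1"
  shows "of_nat n * fps_nth K (Suc n) = - fps_nth (H ^ n) (Suc n)"
proof -
  define D where "D = H - fps_X * fps_deriv H"
  have inv: "H * inverse H = 1"
    using H0 by (simp add: inverse_mult_eq_1')
  have vanish: "fps_nth (H ^ n * D * (fps_X * inverse H) ^ j) (Suc n) = 0" if "j \<le> n" for j
  proof -
    have "H ^ n = H ^ (n - j) * H ^ j" using that by (simp flip: power_add)
    then have "H ^ n * D * (fps_X * inverse H) ^ j = fps_X ^ j * (H ^ (n - j) * D) * (H * inverse H) ^ j"
      by (simp only: power_mult_distrib mult_ac)
    then have "fps_nth (H ^ n * D * (fps_X * inverse H) ^ j) (Suc n) = fps_nth (H ^ (n - j) * D) (Suc (n - j))"
      using that by (simp only: inv power_one mult_1_right mult.assoc fps_X_power_mult_nth)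
        (simp add: Suc_diff_le)
    also have "\<dots> = 0"
      using fps_power_mult_euler_nth[of "n - j" H "Suc (n - j)"] unfolding D_def
      by (simp del: of_nat_Suc)
    finally show ?thesis .
  qed
  have top: "fps_nth (H ^ n * D * (fps_X * inverse H) ^ Suc n) (Suc n) = 1"
  proof -
    have "H ^ n * D * (fps_X * inverse H) ^ Suc n
        = fps_X ^ Suc n * (H ^ n * D * inverse H ^ Suc n)"
      by (simp only: power_mult_distrib mult_ac)
    then show ?thesis
      by (simp only: fps_X_power_mult_nth) (simp add: D_def H0 fps_power_zeroth)
  qed
  \<comment> \<open>One factor \<open>H\<close> cancels the composition. What remains is an Euler
    coefficient with \<open>p = n - 1\<close> and \<open>q = n + 1\<close>, whose factor
    \<open>n - (n + 1) = -1\<close> gives the sign of the result.\<close>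
  have "H ^ n * D * (K oo (fps_X * inverse H)) = H ^ (n - 1) * D * (H * (K oo (fps_X * inverse H)))"
    using n by (cases n) (simp_all add: mult_ac)
  then have "fps_nth (H ^ (n - 1) * D) (Suc n)
      = (\<Sum>j\<le>Suc n. fps_nth K j * fps_nth (H ^ n * D * (fps_X * inverse H) ^ j) (Suc n))"
    using fps_mult_compose_nth[of "fps_X * inverse H" "H ^ n * D" K "Suc n"] by (simp only: eq) simp
  also have "\<dots> = fps_nth K (Suc n)"
    by (simp only: sum.atMost_Suc top) (simp add: vanish)
  finally show ?thesis
    using fps_power_mult_euler_nth[of "n - 1" H "Suc n"] n unfolding D_def
    by (simp add: algebra_simps)
qed

text \<open>The case \<open>n = 0\<close>, where the general formula would divide by 0; comparing
  coefficients of order 1 gives it directly.\<close>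

lemma fps_lagrange_reciprocal_1:
  fixes H K :: "'a :: field fps"
  assumes H0: "fps_nth H 0 = 1" and eq: "H * (K oo (fps_X * inverse H)) = 1"
  shows "fps_nth K 1 = - fps_nth H 1"
proof -
  have K0: "fps_nth K 0 = 1"
    using arg_cong[OF eq, of "\<lambda>F. fps_nth F 0"] H0 by simp
  have "(\<Sum>j\<le>1. fps_nth K j * fps_nth (H * (fps_X * inverse H) ^ j) 1) = 0"
    using fps_mult_compose_nth[of "fps_X * inverse H" H K 1] eq by simp
  then show ?thesis
    using H0 K0 by (simp add: fps_mult_nth_1 add_eq_0_iff)
qed

subsection \<open>Transplantation to the unit disc\<close>

lemma ext_disc_inverse_iff: "z \<noteq> 0 \<Longrightarrow> 1 / z \<in> ext_disc \<longleftrightarrow> norm z < 1"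
  by (simp add: ext_disc_def norm_divide field_simps)

lemma Sigma_class_interior_transplant:
  assumes "g \<in> Sigma_class"
  obtains h H where "h holomorphic_on ball 0 1" "h has_fps_expansion H" "h 0 = 1" "fps_nth H 0 = 1"
    "\<And>z. z \<noteq> 0 \<Longrightarrow> h z = z * g (1 / z)"
proof -
  obtain b where b: "\<And>z. z \<in> ext_disc \<Longrightarrow> (\<lambda>n. b n / z ^ n) sums (g z - z)"
    using assms unfolding Sigma_class_def by auto
  define h where "h = (\<lambda>z. if z = 0 then 1 else z * g (1 / z))"
  define H where "H = Abs_fps (\<lambda>n. if n = 0 then 1 else b (n - 1))"
  have sums: "(\<lambda>n. fps_nth H n * z ^ n) sums h z" if z: "norm z < 1" for z
  proof (cases "z = 0")
    case True
    then show ?thesis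
      using powser_sums_zero[of "fps_nth H"] by (simp add: h_def H_def)
  next
    case False
    have "(\<lambda>n. b n / (1 / z) ^ n) sums (g (1 / z) - 1 / z)"
      using False z by (intro b) (simp add: ext_disc_inverse_iff)
    from sums_mult[OF this, of z] False
    have "(\<lambda>n. fps_nth H (Suc n) * z ^ Suc n) sums (h z - fps_nth H 0 * z ^ 0)"
      by (simp add: H_def h_def right_diff_distrib power_divide mult_ac)
    then show ?thesis by (subst (asm) sums_Suc_iff) simp
  qed
  have "h holomorphic_on ball 0 1"
    by (rule power_series_holomorphic[where a = "fps_nth H"]) (use sums in auto)
  moreover have "h has_fps_expansion H"
    using eventually_nhds_in_open[of "ball 0 1 :: complex set" 0] sums
    by (intro has_fps_expansionI) (auto elim!: eventually_mono)
  ultimately show thesis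
    by (intro that[of h H]) (auto simp: h_def H_def)
qed

text \<open>With \<open>\<zeta> = 1 / z\<close> the logarithmic derivatives satisfy
  \<open>z h'(z) / h(z) = 1 - \<zeta> g'(\<zeta>) / g(\<zeta>)\<close>, so the lower bound at
  \<open>\<zeta>\<close> becomes an upper bound at \<open>z\<close>. At the origin the quotient is 0
  and the claim is \<open>\<alpha> < 1\<close>.\<close>

lemma Sigma_star_interior_transplant:
  assumes "g \<in> Sigma_star \<alpha>" "\<alpha> < 1"
  obtains h H where "h holomorphic_on ball 0 1" "h has_fps_expansion H" "h 0 = 1" "fps_nth H 0 = 1"
    "\<And>z. z \<noteq> 0 \<Longrightarrow> h z = z * g (1 / z)"
    "\<And>z. norm z < 1 \<Longrightarrow> h z \<noteq> 0"
    "\<And>z. norm z < 1 \<Longrightarrow> Re (z * deriv h z / h z) < 1 - \<alpha>"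
proof -
  have g: "g \<in> Sigma_class" and nz: "\<And>z. z \<in> ext_disc \<Longrightarrow> g z \<noteq> 0"
    and re: "\<And>z. z \<in> ext_disc \<Longrightarrow> Re (z * deriv g z / g z) > \<alpha>"
    using assms unfolding Sigma_star_def by auto
  obtain h H where h: "h holomorphic_on ball 0 1" "h has_fps_expansion H" "h 0 = 1" "fps_nth H 0 = 1"
    and hg: "\<And>z. z \<noteq> 0 \<Longrightarrow> h z = z * g (1 / z)"
    using Sigma_class_interior_transplant[OF g] by blast
  have h_nz: "h z \<noteq> 0" if "norm z < 1" for z
    using that h(3) nz by (cases "z = 0") (auto simp: hg ext_disc_inverse_iff)
  have "Re (z * deriv h z / h z) < 1 - \<alpha>" if z: "norm z < 1" for z
  proof (cases "z = 0")
    case False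
    have z': "1 / z \<in> ext_disc" using False z by (simp add: ext_disc_inverse_iff)
    have "g analytic_on ext_disc" using g by (simp add: Sigma_class_def)
    then have "g field_differentiable at (1 / z)"
      using z' analytic_on_imp_differentiable_at by blast
    then have [derivative_intros]: "(g has_field_derivative deriv g (1 / z)) (at (1 / z))"
      by (simp add: field_differentiable_derivI)
    have "((\<lambda>z. z * g (1 / z)) has_field_derivative (g (1 / z) - deriv g (1 / z) / z)) (at z)"
      using False by (auto intro!: derivative_eq_intros DERIV_chain2[of g] simp: field_simps power2_eq_square)
    moreover have "\<forall>\<^sub>F y in nhds z. h y = y * g (1 / y)"
      using eventually_nhds_in_open[of "- {0}" z] False hg
      by (auto simp: open_Compl elim!: eventually_mono)
    ultimately have "deriv h z = g (1 / z) - deriv g (1 / z) / z"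
      by (metis DERIV_imp_deriv deriv_cong_ev)
    then have "z * deriv h z / h z = 1 - (1 / z) * deriv g (1 / z) / g (1 / z)"
      using False nz[OF z'] by (simp add: hg field_simps)
    then show ?thesis using re[OF z'] by simp
  qed (use assms(2) in simp)
  with h hg h_nz show thesis by (intro that[of h H])
qed

lemma schwarz_function_of_half_plane:
  fixes h :: "complex \<Rightarrow> complex"
  assumes h: "h holomorphic_on ball 0 1" "h has_fps_expansion H"
    and nz: "\<And>z. norm z < 1 \<Longrightarrow> h z \<noteq> 0"
    and re: "\<And>z. norm z < 1 \<Longrightarrow> Re (z * deriv h z / h z) < c"
  obtains \<omega> W where "\<omega> holomorphic_on ball 0 1" "\<omega> has_fps_expansion W" "fps_nth W 0 = 0"
    "\<And>z. norm z < 1 \<Longrightarrow> norm (\<omega> z) \<le> 1"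
    "fps_X * fps_deriv H = W * (fps_X * fps_deriv H - fps_const (of_real (2 * c)) * H)"
proof -
  define T where "T = (\<lambda>z. z * deriv h z / h z)"
  define \<omega> where "\<omega> = (\<lambda>z. T z / (T z - of_real (2 * c)))"
  have c: "c > 0" using re[of 0] by simp
  have ne: "T z - of_real (2 * c) \<noteq> 0" if "norm z < 1" for z
    using re[OF that] c by (auto simp: T_def)
  have T: "T holomorphic_on ball 0 1"
    unfolding T_def using h(1) nz by (intro holomorphic_intros) auto
  have hol: "\<omega> holomorphic_on ball 0 1"
    unfolding \<omega>_def using T ne by (intro holomorphic_intros) auto
  define W where "W = fps_expansion \<omega> 0"
  have exp: "\<omega> has_fps_expansion W"
    unfolding W_def using hol by (intro has_fps_expansion_fps_expansion[of "ball 0 1"]) auto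
  have "\<omega> 0 = 0" by (simp add: \<omega>_def T_def)
  then have W0: "fps_nth W 0 = 0"
    using has_fps_expansion_imp_0_eq_fps_nth_0[OF exp] by simp
  have le: "norm (\<omega> z) \<le> 1" if z: "norm z < 1" for z
  proof -
    have "Re (T z) < c" using re[OF z] by (simp add: T_def)
    \<comment> \<open>Points of the half-plane \<open>Re T < c\<close> are closer to 0 than to its
      mirror image \<open>2 * c\<close>, so their quotient of distances is at most 1.\<close>
    then have "(Re (T z))\<^sup>2 \<le> (Re (T z) - 2 * c)\<^sup>2"
      using c by (simp add: power2_eq_square algebra_simps)
    then have "norm (T z) \<le> norm (T z - of_real (2 * c))"
      by (simp add: cmod_def)
    then show ?thesis using ne[OF z] by (simp add: \<omega>_def norm_divide)
  qed
  have "\<forall>\<^sub>F z in nhds 0. z * deriv h z = \<omega> z * (z * deriv h z - of_real (2 * c) * h z)"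
    using eventually_nhds_in_open[of "ball 0 1 :: complex set" 0]
  proof (rule eventually_mono)
    fix z :: complex assume "z \<in> ball 0 1"
    then have z: "norm z < 1" by simp
    have "z * deriv h z = T z * h z" using nz[OF z] by (simp add: T_def)
    then show "z * deriv h z = \<omega> z * (z * deriv h z - of_real (2 * c) * h z)"
      using ne[OF z] by (simp add: \<omega>_def field_simps)
  qed auto
  moreover have "(\<lambda>z. z * deriv h z) has_fps_expansion fps_X * fps_deriv H"
    by (intro fps_expansion_intros h)
  ultimately have "(\<lambda>z. \<omega> z * (z * deriv h z - of_real (2 * c) * h z)) has_fps_expansion fps_X * fps_deriv H"
    by (rule has_fps_expansion_cong[THEN iffD1, OF _ refl])
  moreover have "(\<lambda>z. \<omega> z * (z * deriv h z - of_real (2 * c) * h z)) has_fps_expansion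
      W * (fps_X * fps_deriv H - fps_const (of_real (2 * c)) * H)"
    by (intro fps_expansion_intros h exp)
  ultimately have "fps_X * fps_deriv H = W * (fps_X * fps_deriv H - fps_const (of_real (2 * c)) * H)"
    by (rule fps_expansion_unique_complex)
  with hol exp W0 le show thesis by (intro that)
qed

text \<open>The logarithmic derivative of \<open>H ^ n\<close> is \<open>n\<close> times that of
  \<open>H\<close>; hence the same \<open>W\<close> serves every power, with \<open>b\<close> scaled
  by \<open>n\<close>.\<close>

lemma fps_euler_power:
  fixes H W :: "'a :: field_char_0 fps"
  assumes "fps_X * fps_deriv H = W * (fps_X * fps_deriv H - fps_const b * H)"
  shows "fps_X * fps_deriv (H ^ n)
           = W * (fps_X * fps_deriv (H ^ n) - fps_const (of_nat n * b) * H ^ n)"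
proof (cases n)
  case (Suc m)
  have D: "fps_X * fps_deriv (H ^ n) = fps_const (of_nat n) * H ^ m * (fps_X * fps_deriv H)"
    unfolding fps_deriv_power Suc by (simp add: mult_ac)
  also have "\<dots> = fps_const (of_nat n) * H ^ m * (W * (fps_X * fps_deriv H - fps_const b * H))"
    by (subst assms) (rule refl)
  also have "\<dots> = W * (fps_const (of_nat n) * H ^ m * (fps_X * fps_deriv H)
      - fps_const (of_nat n) * fps_const b * (H ^ m * H))"
    by (simp add: algebra_simps)
  finally show ?thesis
    unfolding D by (simp add: Suc mult_ac)
qed simp

section \<open>Coefficients of the inverse function\<close>

text \<open>For \<open>u = z / h(z) = 1 / g(1 / z)\<close> the inverse function takes
  \<open>1 / u\<close> to \<open>1 / z\<close>, so \<open>K\<close>, the expansion of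
  \<open>u\<close> times the inverse at \<open>1 / u\<close>, has value
  \<open>u / z = 1 / h(z)\<close>. The shift places \<open>B n\<close> at order \<open>Suc n\<close>
  of \<open>K\<close>.\<close>

lemma inverse_expansion_reciprocal:
  assumes inj: "inj_on g ext_disc"
    and h: "h has_fps_expansion H" "h 0 = 1" "fps_nth H 0 = 1"
    and hg: "\<And>z. z \<noteq> 0 \<Longrightarrow> h z = z * g (1 / z)"
    and B: "inverse_expansion g B"
  defines "K \<equiv> Abs_fps (\<lambda>n. if n = 0 then 1 else B (n - 1))"
  shows "H * (K oo (fps_X * inverse H)) = 1"
proof -
  define k where "k = (\<lambda>u. if u = 0 then 1 else u * inv_into ext_disc g (1 / u))"
  define \<phi> where "\<phi> = (\<lambda>z. z * inverse (h z))"
  have "\<forall>\<^sub>F u in at 0. (\<lambda>n. B n / inverse u ^ n) sums (inv_into ext_disc g (inverse u) - inverse u)"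
    using B unfolding inverse_expansion_def at_to_infinity eventually_filtermap
    by (auto elim!: eventually_mono)
  moreover have "\<forall>\<^sub>F u in at (0 :: complex). u \<noteq> 0"
    by (simp add: eventually_at_filter)
  ultimately have "\<forall>\<^sub>F u in at 0. (\<lambda>n. fps_nth K n * u ^ n) sums k u"
  proof eventually_elim
    case (elim u)
    from sums_mult[OF elim(1), of u] elim(2)
    have "(\<lambda>n. fps_nth K (Suc n) * u ^ Suc n) sums (k u - fps_nth K 0 * u ^ 0)"
      by (simp add: K_def k_def right_diff_distrib divide_inverse power_inverse mult_ac)
    then show ?case by (subst (asm) sums_Suc_iff) simp
  qed
  moreover have "(\<lambda>n. fps_nth K n * 0 ^ n) sums k 0"
    using powser_sums_zero[of "fps_nth K"] by (simp add: k_def K_def)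
  ultimately have k: "k has_fps_expansion K"
    by (intro has_fps_expansionI) (simp add: eventually_nhds_conv_at)
  have \<phi>: "\<phi> has_fps_expansion fps_X * inverse H"
    unfolding \<phi>_def by (intro fps_expansion_intros h) (simp add: h(3))
  have prod: "(\<lambda>z. h z * (k \<circ> \<phi>) z) has_fps_expansion H * (K oo (fps_X * inverse H))"
    by (intro fps_expansion_intros h k \<phi>) simp
  have one: "\<forall>\<^sub>F z in nhds 0. h z * (k \<circ> \<phi>) z = 1"
  proof -
    have "\<forall>\<^sub>F z in nhds 0. h z \<noteq> 0"
    proof -
      have "isCont h 0" using has_fps_expansion_imp_continuous[OF h(1)] by simp
      then have "(h \<longlongrightarrow> 1) (nhds 0)" using h(2) by (simp add: isCont_def tendsto_nhds_iff)
      then show ?thesis by (rule tendsto_imp_eventually_ne) simp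
    qed
    moreover have "\<forall>\<^sub>F z in nhds 0. z \<in> ball (0 :: complex) 1"
      by (intro eventually_nhds_in_open) auto
    ultimately show ?thesis
    proof eventually_elim
      case (elim z)
      show ?case
      proof (cases "z = 0")
        case False
        have "1 / \<phi> z = g (1 / z)" "\<phi> z \<noteq> 0"
          using False elim(1) hg[OF False] by (auto simp: \<phi>_def field_simps)
        moreover have "inv_into ext_disc g (g (1 / z)) = 1 / z"
          using elim(2) False inj by (intro inv_into_f_f) (auto simp: ext_disc_inverse_iff)
        ultimately show ?thesis
          using False elim(1) by (simp add: k_def) (simp add: \<phi>_def)
      qed (simp add: k_def \<phi>_def h(2))
    qed
  qed
  have "(\<lambda>z. 1) has_fps_expansion H * (K oo (fps_X * inverse H))"
    by (rule iffD1[OF has_fps_expansion_cong[OF one refl] prod])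
  then show ?thesis
    by (rule fps_expansion_unique_complex) (rule has_fps_expansion_1)
qed

lemma inverse_coefficient_eq:
  assumes "inj_on g ext_disc"
    and h: "h has_fps_expansion H" "h 0 = 1" "fps_nth H 0 = 1"
    and "\<And>z. z \<noteq> 0 \<Longrightarrow> h z = z * g (1 / z)"
    and "inverse_expansion g B"
  shows "B 0 = - fps_nth H 1" and "n \<ge> 1 \<Longrightarrow> of_nat n * B n = - fps_nth (H ^ n) (Suc n)"
  using fps_lagrange_reciprocal_1[OF h(3) inverse_expansion_reciprocal[OF assms]]
    fps_lagrange_reciprocal[OF h(3) inverse_expansion_reciprocal[OF assms]]
  by simp_all

lemma Sigma_star_inj_on: "g \<in> Sigma_star \<alpha> \<Longrightarrow> inj_on g ext_disc"
  by (simp add: Sigma_star_def Sigma_class_def)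

lemma Sigma_star_inverse_coefficients:
  assumes g: "g \<in> Sigma_star \<alpha>" and \<alpha>: "\<alpha> < 1" and B: "inverse_expansion g B"
  obtains H where "fps_nth H 0 = 1" "B 0 = - fps_nth H 1"
    "\<And>n. n \<ge> 1 \<Longrightarrow> of_nat n * B n = - fps_nth (H ^ n) (Suc n)"
    "\<And>n m. (real m * norm (fps_nth (H ^ n) m))\<^sup>2
        \<le> (\<Sum>j<m. 2 * real n * (1 - \<alpha>) * (2 * real n * (1 - \<alpha>) - 2 * real j) * (norm (fps_nth (H ^ n) j))\<^sup>2)"
proof -
  obtain h H where h: "h holomorphic_on ball 0 1" "h has_fps_expansion H" "h 0 = 1" "fps_nth H 0 = 1"
    and hg: "\<And>z. z \<noteq> 0 \<Longrightarrow> h z = z * g (1 / z)"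
    and nz: "\<And>z. norm z < 1 \<Longrightarrow> h z \<noteq> 0"
    and re: "\<And>z. norm z < 1 \<Longrightarrow> Re (z * deriv h z / h z) < 1 - \<alpha>"
    using Sigma_star_interior_transplant[OF g \<alpha>] by blast
  obtain \<omega> W where \<omega>: "\<omega> holomorphic_on ball 0 1" "\<omega> has_fps_expansion W" "fps_nth W 0 = 0"
    "\<And>z. norm z < 1 \<Longrightarrow> norm (\<omega> z) \<le> 1"
    and eq: "fps_X * fps_deriv H = W * (fps_X * fps_deriv H - fps_const (of_real (2 * (1 - \<alpha>))) * H)"
    using schwarz_function_of_half_plane[OF h(1,2) nz re] by blast
  have "fps_X * fps_deriv (H ^ n) = W * (fps_X * fps_deriv (H ^ n)
      - fps_const (of_real (2 * real n * (1 - \<alpha>))) * H ^ n)" for n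
    using fps_euler_power[OF eq, of n] by (simp add: mult_ac)
  from clunie_coefficient_inequality[OF \<omega>(1,2,4,3) this]
    inverse_coefficient_eq[OF Sigma_star_inj_on[OF g] h(2,3,4) hg B]
  show thesis using h(4) by (intro that[of H]) auto
qed

section \<open>The estimates (a), (b) and (c)\<close>

lemma Sigma_star_inverse_coefficient_0:
  assumes "g \<in> Sigma_star \<alpha>" "\<alpha> < 1" "inverse_expansion g B"
  shows "norm (B 0) \<le> 2 * (1 - \<alpha>)"
proof -
  obtain H where H: "fps_nth H 0 = 1" "B 0 = - fps_nth H 1"
    and ineq: "\<And>n m. (real m * norm (fps_nth (H ^ n) m))\<^sup>2
        \<le> (\<Sum>j<m. 2 * real n * (1 - \<alpha>) * (2 * real n * (1 - \<alpha>) - 2 * real j) * (norm (fps_nth (H ^ n) j))\<^sup>2)"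
    by (rule Sigma_star_inverse_coefficients[OF assms]) (rule that; assumption)
  have "(norm (B 0))\<^sup>2 \<le> (2 * (1 - \<alpha>))\<^sup>2"
    using ineq[where m = 1 and n = 1] by (simp add: H power2_eq_square)
  then show ?thesis
    by (rule power2_le_imp_le) (use assms(2) in simp)
qed

text \<open>Here \<open>\<beta> / 2 = n * (1 - \<alpha>)\<close>, so \<open>M\<close> is a cut where
  the Clunie weights change sign. The bound concerns order \<open>n + 1\<close> of
  \<open>H ^ n\<close>, and Lagrange inversion supplies the further factor \<open>n\<close> in the
  denominator.\<close>

lemma Sigma_star_inverse_coefficient_bound:
  assumes "g \<in> Sigma_star \<alpha>" and \<alpha>: "\<alpha> < 1" and "inverse_expansion g B"
    and n: "n \<ge> 1" "M \<le> Suc n"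
    and pos: "\<And>i. i < M \<Longrightarrow> real i \<le> real n * (1 - \<alpha>)"
    and neg: "\<And>i. M \<le> i \<Longrightarrow> real n * (1 - \<alpha>) \<le> real i"
  shows "norm (B n) \<le> real M * \<bar>2 * real n * (1 - \<alpha>) gchoose M\<bar> / (real n * (real n + 1))"
proof -
  obtain H where H: "fps_nth H 0 = 1" "\<And>n. n \<ge> 1 \<Longrightarrow> of_nat n * B n = - fps_nth (H ^ n) (Suc n)"
    and ineq: "\<And>n m. (real m * norm (fps_nth (H ^ n) m))\<^sup>2
        \<le> (\<Sum>j<m. 2 * real n * (1 - \<alpha>) * (2 * real n * (1 - \<alpha>) - 2 * real j) * (norm (fps_nth (H ^ n) j))\<^sup>2)"
    by (rule Sigma_star_inverse_coefficients[OF assms(1-3)]) (rule that; assumption)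
  have "real (Suc n) * norm (fps_nth (H ^ n) (Suc n)) \<le> real M * \<bar>2 * real n * (1 - \<alpha>) gchoose M\<bar>"
  proof (rule coefficient_bound_from_clunie[of "fps_nth (H ^ n)"])
    show "fps_nth (H ^ n) 0 = 1" by (simp add: H fps_power_zeroth)
    show "2 * real i \<le> 2 * real n * (1 - \<alpha>)" if "i < M" for i
      using pos[OF that] by simp
    show "2 * real n * (1 - \<alpha>) \<le> 2 * real i" if "M \<le> i" for i
      using neg[OF that] by simp
  qed (use ineq \<alpha> n in auto)
  moreover have eq: "real n * norm (B n) = norm (fps_nth (H ^ n) (Suc n))"
    using arg_cong[OF H(2)[OF n(1)], of norm] by (simp add: norm_mult)
  ultimately have "norm (B n) * (real n * (real n + 1)) \<le> real M * \<bar>2 * real n * (1 - \<alpha>) gchoose M\<bar>"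
    unfolding eq[symmetric] by (simp add: algebra_simps)
  then show ?thesis
    using n(1) by (subst pos_le_divide_eq) auto
qed

lemma gbinomial_Gamma_ratio:
  fixes \<beta> :: real
  assumes "M \<ge> 1" "\<beta> \<ge> 0"
  shows "real M * (\<beta> gchoose M) = Gamma (\<beta> + 1) / (Gamma (real M) * Gamma (\<beta> + 1 - real M))"
proof -
  obtain m where m: "M = Suc m" using assms(1) by (cases M) auto
  have "(\<beta> gchoose M) = Gamma (\<beta> + 1) / (fact M * Gamma (\<beta> - real M + 1))"
    using assms(2) by (intro gbinomial_Gamma) (auto elim!: nonpos_Ints_cases)
  moreover have "Gamma (real M) = fact m"
    using Gamma_fact[of m, where ?'a = real] by (simp add: m add_ac)
  ultimately show ?thesis
    by (simp add: m field_simps del: of_nat_Suc)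
qed

lemma Sigma_star_inverse_coefficient_Gamma_bound:
  assumes "g \<in> Sigma_star \<alpha>" "\<alpha> < 1" "inverse_expansion g B"
    and k: "k + 2 \<le> n" "\<alpha> \<in> subinterval k n"
  shows "norm (B n) \<le> Gamma (2 * real n * (1 - \<alpha>) + 1) /
             (real n * (real n + 1) * Gamma (real n - real k) *
              Gamma (2 * real n * (1 - \<alpha>) + 1 - (real n - real k)))"
proof -
  \<comment> \<open>\<open>\<alpha> \<in> subinterval k n\<close> means
    \<open>n - k - 1 < n * (1 - \<alpha>) \<le> n - k\<close>, which makes \<open>n - k\<close> the
    cut.\<close>
  define M where "M = n - k"
  define \<beta> where "\<beta> = 2 * real n * (1 - \<alpha>)"
  have M: "real M = real n - real k" "M \<ge> 2" "M \<le> Suc n"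
    using k(1) by (auto simp: M_def)
  have up: "real n * (1 - \<alpha>) \<le> real M" and low: "real M - 1 < real n * (1 - \<alpha>)"
    using k M by (auto simp: subinterval_def field_simps)
  have "norm (B n) \<le> real M * \<bar>\<beta> gchoose M\<bar> / (real n * (real n + 1))"
    unfolding \<beta>_def
  proof (rule Sigma_star_inverse_coefficient_bound[OF assms(1-3)])
    fix i
    show "real i \<le> real n * (1 - \<alpha>)" if "i < M" using that low by linarith
    show "real n * (1 - \<alpha>) \<le> real i" if "M \<le> i" using that up by linarith
  qed (use k M in auto)
  also have "real M * \<bar>\<beta> gchoose M\<bar> = \<bar>real M * (\<beta> gchoose M)\<bar>"
    by (simp add: abs_mult)
  also have "\<dots> = Gamma (\<beta> + 1) / (Gamma (real M) * Gamma (\<beta> + 1 - real M))"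
  proof -
    \<comment> \<open>Both Gamma arguments involving \<open>\<beta>\<close> are positive, so the
      absolute value can be removed.\<close>
    have "\<beta> + 1 - real M > 0" "\<beta> > 0" using low M(2) by (auto simp: \<beta>_def)
    then show ?thesis
      using M(2) by (subst gbinomial_Gamma_ratio) (auto intro!: Gamma_real_nonneg)
  qed
  finally show ?thesis
    by (simp add: M(1) \<beta>_def mult_ac)
qed

lemma Sigma_star_inverse_coefficient_last_bound:
  assumes "g \<in> Sigma_star \<alpha>" "\<alpha> < 1" "inverse_expansion g B"
    and n: "n \<ge> 1" "\<alpha> \<in> subinterval (n - 1) n"
  shows "norm (B n) \<le> 2 * (1 - \<alpha>) / (real n + 1)"
proof -
  have up: "real n * (1 - \<alpha>) \<le> 1"
    using n by (auto simp: subinterval_def field_simps of_nat_diff)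
  have "norm (B n) \<le> real 1 * \<bar>2 * real n * (1 - \<alpha>) gchoose 1\<bar> / (real n * (real n + 1))"
  proof (rule Sigma_star_inverse_coefficient_bound[OF assms(1-3)])
    fix i
    show "real i \<le> real n * (1 - \<alpha>)" if "i < 1" using that assms(2) by simp
    show "real n * (1 - \<alpha>) \<le> real i" if "1 \<le> i" using that up by linarith
  qed (use n in auto)
  then show ?thesis using n(1) assms(2) by (simp add: abs_mult)
qed

subsection \<open>Extremal functions\<close>

text \<open>
  In the coordinate \<open>s = ln z\<close> the map becomes \<open>s - L (exp s)\<close> on the left half-plane,
  which is convex, and its derivative has positive real part (the Noshiro--Warschawski criterion).
\<close>

lemma starlike_inj_on:
  assumes L: "L holomorphic_on ball 0 1"
    and re: "\<And>z. norm z < 1 \<Longrightarrow> Re (z * deriv L z) < 1"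
  shows "inj_on (\<lambda>z. z * exp (- L z)) (ball 0 1 - {0})"
proof (rule inj_onI)
  fix x y :: complex
  assume xy: "x \<in> ball 0 1 - {0}" "y \<in> ball 0 1 - {0}" and eq: "x * exp (- L x) = y * exp (- L y)"
  define F where "F = (\<lambda>s. s - L (exp s))"
  have expF: "exp (F s) = exp s * exp (- L (exp s))" for s
    by (simp add: F_def exp_diff exp_minus field_simps)
  have "exp (F (Ln x)) = exp (F (Ln y))"
    using xy eq by (simp add: expF)
  then obtain n :: int where n: "F (Ln x) = F (Ln y) + of_int (2 * n) * of_real pi * \<i>"
    by (auto simp: exp_eq)
  \<comment> \<open>Equal exponentials fix \<open>F\<close> only up to a period. The period is moved
    into \<open>t\<close>, which is harmless because \<open>L (exp s)\<close> is periodic.\<close>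
  define s t where "s = Ln x" and "t = Ln y + of_int (2 * n) * of_real pi * \<i>"
  have exp_t: "exp t = y"
  proof -
    have "exp t = exp (Ln y)" unfolding t_def exp_eq by (intro exI[of _ n]) simp
    then show ?thesis using xy by simp
  qed
  have exp_s: "exp s = x" using xy by (simp add: s_def)
  have F_eq: "F s = F t"
    using n xy exp_t by (simp add: F_def s_def t_def)
  have "Re s < 0" "Re t < 0"
    using xy exp_s exp_t by (auto simp flip: exp_less_one_iff norm_exp_eq_Re)
  have seg: "Re u < 0" if "u \<in> closed_segment s t" for u
  proof -
    have "closed_segment s t \<subseteq> {u. Re u < 0}"
      using \<open>Re s < 0\<close> \<open>Re t < 0\<close> by (intro closed_segment_subset convex_halfspace_Re_lt) auto
    with that show ?thesis by auto
  qed
  have "s = t"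
  proof (rule ccontr)
    assume "s \<noteq> t"
    \<comment> \<open>Dividing by \<open>t - s\<close> lets the mean value theorem produce the real
      part of the derivative of \<open>F\<close> itself, which is positive, although
      \<open>F\<close> agrees at the two ends.\<close>
    have "((\<lambda>u. F u / (t - s)) has_field_derivative (1 - exp u * deriv L (exp u)) / (t - s)) (at u)"
      if "u \<in> closed_segment s t" for u
    proof -
      have "norm (exp u) < 1" using seg[OF that] by (simp add: norm_exp_eq_Re)
      then have "(L has_field_derivative deriv L (exp u)) (at (exp u))"
        by (intro holomorphic_derivI[OF L]) auto
      then show ?thesis
        unfolding F_def using \<open>s \<noteq> t\<close>
        by (auto intro!: derivative_eq_intros DERIV_chain2[of L])
    qed
    from complex_mvt_line[OF this] obtain u where u: "u \<in> closed_segment s t"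
      "Re (F t / (t - s)) - Re (F s / (t - s)) = Re ((1 - exp u * deriv L (exp u)) / (t - s) * (t - s))"
      by blast
    moreover have "Re (exp u * deriv L (exp u)) < 1"
      using seg[OF u(1)] by (intro re) (simp add: norm_exp_eq_Re)
    ultimately show False using F_eq \<open>s \<noteq> t\<close> by simp
  qed
  then show "x = y" using exp_s exp_t by simp
qed

text \<open>Prescribing a logarithm \<open>L\<close> of \<open>h\<close> makes nonvanishing
  automatic and turns \<open>z h' / h\<close> into \<open>z L'\<close>. Univalence follows by
  applying \<open>starlike_inj_on\<close> to \<open>1 / g\<close> in the coordinate
  \<open>1 / z\<close>.\<close>

lemma Sigma_star_of_logarithm:
  assumes L: "L holomorphic_on ball 0 1" "L 0 = 0" and \<alpha>: "\<alpha> \<ge> 0"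
    and re: "\<And>z. norm z < 1 \<Longrightarrow> Re (z * deriv L z) < 1 - \<alpha>"
  shows "(\<lambda>z. z * exp (L (1 / z))) \<in> Sigma_star \<alpha>"
proof -
  define g where "g = (\<lambda>z. z * exp (L (1 / z)))"
  have ext: "z \<noteq> 0" "norm (1 / z) < 1" if "z \<in> ext_disc" for z
    using that by (auto simp: ext_disc_def norm_divide divide_less_eq_1)
  have deriv_g: "(g has_field_derivative exp (L (1 / z)) * (1 - (1 / z) * deriv L (1 / z))) (at z)"
    if "z \<in> ext_disc" for z
  proof -
    have "(L has_field_derivative deriv L (1 / z)) (at (1 / z))"
      using ext[OF that] by (intro holomorphic_derivI[OF L(1)]) auto
    then show ?thesis
      unfolding g_def using ext[OF that]
      by (auto intro!: derivative_eq_intros DERIV_chain2[of L] simp: field_simps power2_eq_square)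
  qed
  have open_ext: "open ext_disc"
    unfolding ext_disc_def by (intro open_Collect_less continuous_intros)
  have "g holomorphic_on ext_disc"
    using deriv_g open_ext by (auto simp: holomorphic_on_open)
  then have "g analytic_on ext_disc"
    using open_ext by (simp add: analytic_on_open)
  moreover have "inj_on g ext_disc"
  proof (rule inj_onI)
    fix x y assume xy: "x \<in> ext_disc" "y \<in> ext_disc" "g x = g y"
    have "inverse (g x) = inverse (g y)" using xy(3) by simp
    then have "1 / x * exp (- L (1 / x)) = 1 / y * exp (- L (1 / y))"
      by (simp add: g_def exp_minus divide_inverse)
    moreover have "inj_on (\<lambda>z. z * exp (- L z)) (ball 0 1 - {0})"
      using re \<alpha> by (intro starlike_inj_on[OF L(1)]) force
    ultimately have "1 / x = 1 / y"
      using ext[OF xy(1)] ext[OF xy(2)] by (auto dest!: inj_onD[of _ _ "1 / x" "1 / y"])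
    then show "x = y" by simp
  qed
  moreover have "\<exists>b. \<forall>z\<in>ext_disc. (\<lambda>n. b n / z ^ n) sums (g z - z)"
  proof -
    have hol: "(\<lambda>z. exp (L z)) holomorphic_on ball 0 1"
      using L(1) by (intro holomorphic_intros)
    define c where "c = fps_nth (fps_expansion (\<lambda>z. exp (L z)) 0)"
    have c: "(\<lambda>n. c n * z ^ n) sums exp (L z)" if "norm z < 1" for z
      unfolding c_def using hol that
      by (intro has_fps_expansion_imp_sums_complex[where r = 1]
            has_fps_expansion_fps_expansion[of "ball 0 1"])
         (auto simp: one_ereal_def)
    have c0: "c 0 = 1"
      using L(2) by (simp add: c_def fps_expansion_def)
    have "(\<lambda>n. c (Suc n) / z ^ n) sums (g z - z)" if "z \<in> ext_disc" for z
    proof -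
      have "(\<lambda>n. c (Suc n) * (1 / z) ^ Suc n) sums (exp (L (1 / z)) - c 0 * (1 / z) ^ 0)"
        using c[OF ext(2)[OF that]] by (subst sums_Suc_iff) simp
      from sums_mult[OF this, of z] show ?thesis
        using ext(1)[OF that] by (simp add: g_def c0 right_diff_distrib power_divide)
    qed
    then show ?thesis by (intro exI[of _ "\<lambda>n. c (Suc n)"]) simp
  qed
  moreover have "g z \<noteq> 0 \<and> Re (z * deriv g z / g z) > \<alpha>" if z: "z \<in> ext_disc" for z
  proof
    show "g z \<noteq> 0" using ext[OF z] by (simp add: g_def)
    have "z * deriv g z / g z = 1 - (1 / z) * deriv L (1 / z)"
      unfolding DERIV_imp_deriv[OF deriv_g[OF z]] using ext[OF z] by (simp add: g_def)
    then show "Re (z * deriv g z / g z) > \<alpha>"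
      using re[OF ext(2)[OF z]] by simp
  qed
  ultimately show ?thesis
    unfolding Sigma_star_def Sigma_class_def g_def by blast
qed

text \<open>Supplies the coefficients \<open>B\<close> for the extremal functions:
  \<open>\<phi>(z) = 1 / g(1 / z)\<close> extends injectively over 0, and its open image contains a
  disc around 0.\<close>

lemma inverse_expansion_exists:
  assumes g: "g \<in> Sigma_star \<alpha>" and \<alpha>: "\<alpha> < 1"
  shows "\<exists>B. inverse_expansion g B"
proof -
  obtain h H where h: "h holomorphic_on ball 0 1" "h 0 = 1"
    and hg: "\<And>z. z \<noteq> 0 \<Longrightarrow> h z = z * g (1 / z)"
    and nz: "\<And>z. norm z < 1 \<Longrightarrow> h z \<noteq> 0"
    by (rule Sigma_star_interior_transplant[OF g \<alpha>]) (rule that; assumption)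
  have inj: "inj_on g ext_disc" using g by (rule Sigma_star_inj_on)
  define \<phi> where "\<phi> = (\<lambda>z. z / h z)"
  have \<phi>_hol: "\<phi> holomorphic_on ball 0 1"
    unfolding \<phi>_def using h(1) nz by (intro holomorphic_intros) auto
  have \<phi>_inv: "1 / \<phi> z = g (1 / z)" if "z \<noteq> 0" for z
    using that by (simp add: \<phi>_def hg)
  have \<phi>_inj: "inj_on \<phi> (ball 0 1)"
  proof (rule inj_onI)
    fix x y :: complex assume xy: "x \<in> ball 0 1" "y \<in> ball 0 1" "\<phi> x = \<phi> y"
    show "x = y"
    proof (cases "x = 0 \<or> y = 0")
      case True
      then show ?thesis using xy nz[of x] nz[of y] by (auto simp: \<phi>_def)
    next
      case False
      then have "g (1 / x) = 1 / \<phi> x" "g (1 / y) = 1 / \<phi> y" by (auto simp: \<phi>_inv)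
      then have "g (1 / x) = g (1 / y)" using xy(3) by (simp only:)
      then have "1 / x = 1 / y"
        by (rule inj_onD[OF inj]) (use False xy in \<open>auto simp: ext_disc_inverse_iff\<close>)
      then show ?thesis by simp
    qed
  qed
  obtain \<psi> where \<psi>: "\<psi> holomorphic_on \<phi> ` ball 0 1" "\<And>z. z \<in> ball 0 1 \<Longrightarrow> \<psi> (\<phi> z) = z"
    using holomorphic_has_inverse[OF \<phi>_hol open_ball \<phi>_inj] by metis
  have "open (\<phi> ` ball 0 1)"
    using open_mapping_thm3[OF \<phi>_hol open_ball \<phi>_inj] .
  moreover have \<phi>0: "\<phi> 0 = 0" by (simp add: \<phi>_def)
  then have "0 \<in> \<phi> ` ball 0 1" by (metis centre_in_ball image_eqI zero_less_one)
  ultimately obtain r where r: "r > 0" "ball 0 r \<subseteq> \<phi> ` ball 0 1"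
    by (meson open_contains_ball)
  \<comment> \<open>This is \<open>u / \<psi>(u)\<close> written without the removable singularity
    at 0.\<close>
  define k where "k = (\<lambda>u. 1 / h (\<psi> u))"
  have k_hol: "k holomorphic_on ball 0 r"
  proof -
    have img: "\<psi> ` \<phi> ` ball 0 1 \<subseteq> ball 0 1" using \<psi>(2) by auto
    have comp: "(h \<circ> \<psi>) holomorphic_on \<phi> ` ball 0 1"
      by (rule holomorphic_on_compose_gen[OF \<psi>(1) h(1) img])
    have "(\<lambda>u. 1 / (h \<circ> \<psi>) u) holomorphic_on \<phi> ` ball 0 1"
      by (rule holomorphic_on_divide[OF holomorphic_on_const comp]) (use nz \<psi>(2) in auto)
    then show ?thesis
      unfolding k_def using r(2) by (auto intro: holomorphic_on_subset)
  qed
  define K where "K = fps_nth (fps_expansion k 0)"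
  have K: "(\<lambda>n. K n * u ^ n) sums k u" if "norm u < r" for u
    unfolding K_def using k_hol that r(1)
    by (intro has_fps_expansion_imp_sums_complex[where r = "ereal r"]
          has_fps_expansion_fps_expansion[of "ball 0 r"]) auto
  have K0: "K 0 = 1"
    using \<psi>(2)[of 0] h(2) by (simp add: K_def fps_expansion_def k_def \<phi>0)
  have "w \<in> g ` ext_disc \<and> (\<lambda>n. K (Suc n) / w ^ n) sums (inv_into ext_disc g w - w)"
    if w: "norm w > 1 / r" for w
  proof -
    have "w \<noteq> 0" using w r(1) by (auto simp: field_simps)
    have "norm (1 / w) < r"
      using w r(1) \<open>w \<noteq> 0\<close> by (simp add: norm_divide field_simps)
    then obtain z where z: "norm z < 1" "1 / w = \<phi> z" using r(2) by fastforce
    have "z \<noteq> 0" using z(2) \<open>w \<noteq> 0\<close> \<phi>0 by auto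
    have w_eq: "w = g (1 / z)" using z(2) \<phi>_inv[OF \<open>z \<noteq> 0\<close>] by (metis div_by_1 divide_divide_eq_right mult_1)
    have z': "1 / z \<in> ext_disc" using z \<open>z \<noteq> 0\<close> by (simp add: ext_disc_inverse_iff)
    have inv: "inv_into ext_disc g w = 1 / z"
      unfolding w_eq using inj z' by (rule inv_into_f_f)
    have "k (1 / w) = 1 / h z"
      using \<psi>(2)[of z] z by (simp add: k_def)
    also have "\<dots> = 1 / (z * w)" using \<open>z \<noteq> 0\<close> by (simp add: hg w_eq)
    finally have "(\<lambda>n. K (Suc n) * (1 / w) ^ Suc n) sums (1 / (z * w) - K 0 * (1 / w) ^ 0)"
      using K[OF \<open>norm (1 / w) < r\<close>] by (subst sums_Suc_iff) simp
    from sums_mult[OF this, of w] have "(\<lambda>n. K (Suc n) / w ^ n) sums (inv_into ext_disc g w - w)"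
      using \<open>w \<noteq> 0\<close> by (simp add: K0 inv right_diff_distrib power_divide)
    then show ?thesis using z' w_eq by blast
  qed
  then show ?thesis
    unfolding inverse_expansion_def eventually_at_infinity
    by (intro exI[of _ "\<lambda>n. K (Suc n)"] exI[of _ "1 / r + 1"]) auto
qed

text \<open>One family serves both sharpness claims, \<open>n = 0\<close> giving (a). It belongs to
  the class for every \<open>\<alpha>\<close> in \<open>[0, 1)\<close>, whatever the
  subinterval.\<close>

lemma Sigma_star_inverse_coefficient_sharp:
  assumes \<alpha>: "0 \<le> \<alpha>" "\<alpha> < 1"
  shows "\<exists>g B. g \<in> Sigma_star \<alpha> \<and> inverse_expansion g B \<and> norm (B n) = 2 * (1 - \<alpha>) / (real n + 1)"
proof -
  define N where "N = Suc n"
  define c where "c = 2 * (1 - \<alpha>)"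
  define L where "L = (\<lambda>z. of_real (c / real N) * Ln (1 - z ^ N))"
  have pos: "Re (1 - z ^ N) > 0" if "norm z < 1" for z :: complex
  proof -
    have "norm (z ^ N) < 1" using that by (simp add: norm_power power_less_one_iff N_def del: power_Suc)
    then show ?thesis using complex_Re_le_cmod[of "z ^ N"] by simp
  qed
  have slit: "1 - z ^ N \<notin> \<real>\<^sub>\<le>\<^sub>0" if "norm z < 1" for z :: complex
    using pos[OF that] complex_nonpos_Reals_iff by fastforce
  have L_deriv: "(L has_field_derivative - of_real c * z ^ n / (1 - z ^ N)) (at z)" if "norm z < 1" for z
    unfolding L_def using slit[OF that]
    by (auto intro!: derivative_eq_intros simp: N_def divide_inverse simp del: power_Suc of_nat_Suc)
  have L_hol: "L holomorphic_on ball 0 1"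
    unfolding holomorphic_on_open[OF open_ball] using L_deriv by (metis mem_ball_0)
  have L0: "L 0 = 0" by (simp add: L_def N_def)
  have zL: "z * deriv L z = - of_real c * z ^ N / (1 - z ^ N)" if "norm z < 1" for z
    using DERIV_imp_deriv[OF L_deriv[OF that]] by (simp add: N_def)
  have re: "Re (z * deriv L z) < 1 - \<alpha>" if z: "norm z < 1" for z
  proof -
    define X where "X = z ^ N"
    have X: "norm X < 1" using z by (simp add: X_def norm_power power_less_one_iff N_def del: power_Suc)
    have ne: "1 - X \<noteq> 0" using X by auto
    \<comment> \<open>The Cayley transform \<open>(1 + X) / (1 - X)\<close> maps the unit disc to
      the right half-plane.\<close>
    have eq: "- of_real c * X / (1 - X) = of_real (1 - \<alpha>) * (1 - (1 + X) / (1 - X))"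
      unfolding c_def using ne by (simp add: field_simps)
    have "Re ((1 + X) / (1 - X)) > 0"
    proof -
      have "Re ((1 + X) / (1 - X)) = (1 - (norm X)\<^sup>2) / (norm (1 - X))\<^sup>2"
        unfolding Re_divide cmod_power2 by (simp add: power2_eq_square algebra_simps)
      then show ?thesis using X ne by (simp add: power_less_one_iff abs_square_less_1)
    qed
    from mult_pos_pos[OF _ this, of "1 - \<alpha>"] \<alpha>(2)
    have "(1 - \<alpha>) * (1 - Re ((1 + X) / (1 - X))) < 1 - \<alpha>"
      by (simp add: right_diff_distrib del: Re_divide)
    moreover have "Re (of_real (1 - \<alpha>) * (1 - (1 + X) / (1 - X))) = (1 - \<alpha>) * (1 - Re ((1 + X) / (1 - X)))"
      by (simp only: times_complex.sel minus_complex.sel Re_complex_of_real Im_complex_of_real one_complex.sel)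
    ultimately show ?thesis
      unfolding zL[OF z] X_def[symmetric] eq by simp
  qed
  define g where "g = (\<lambda>z. z * exp (L (1 / z)))"
  have g: "g \<in> Sigma_star \<alpha>"
    unfolding g_def using L_hol L0 \<alpha>(1) re by (rule Sigma_star_of_logarithm)
  obtain B where B: "inverse_expansion g B"
    using inverse_expansion_exists[OF g \<alpha>(2)] by blast
  define h where "h = (\<lambda>z. exp (L z))"
  define H where "H = fps_expansion h 0"
  have h: "h has_fps_expansion H" "h 0 = 1"
    unfolding H_def using L_hol
    by (auto simp: h_def L0 intro!: has_fps_expansion_fps_expansion[of "ball 0 1"] holomorphic_intros)
  have H0: "fps_nth H 0 = 1"
    using has_fps_expansion_imp_0_eq_fps_nth_0[OF h(1)] h(2) by simp
  have hg: "h z = z * g (1 / z)" if "z \<noteq> 0" for z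
    using that by (simp add: h_def g_def)
  have ode: "fps_X * fps_deriv H = fps_X ^ N * (fps_X * fps_deriv H - fps_const (of_real c) * H)"
  proof (rule fps_expansion_unique_complex)
    have "\<forall>\<^sub>F z in nhds 0. z * deriv h z = z ^ N * (z * deriv h z - of_real c * h z)"
      using eventually_nhds_in_open[of "ball 0 1 :: complex set" 0]
    proof (rule eventually_mono)
      fix z :: complex assume "z \<in> ball 0 1"
      then have z: "norm z < 1" by simp
      have "(h has_field_derivative h z * deriv L z) (at z)"
        unfolding h_def using L_deriv[OF z] DERIV_imp_deriv[OF L_deriv[OF z]]
        by (auto intro!: derivative_eq_intros)
      then have "z * deriv h z = h z * (z * deriv L z)"
        by (simp add: DERIV_imp_deriv)
      then have "z * deriv h z = h z * (- of_real c * z ^ N / (1 - z ^ N))"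
        unfolding zL[OF z] .
      moreover have "1 - z ^ N \<noteq> 0" using pos[OF z] by auto
      ultimately show "z * deriv h z = z ^ N * (z * deriv h z - of_real c * h z)"
        by (simp add: field_simps)
    qed auto
    moreover have "(\<lambda>z. z ^ N * (z * deriv h z - of_real c * h z)) has_fps_expansion
        fps_X ^ N * (fps_X * fps_deriv H - fps_const (of_real c) * H)"
      by (intro fps_expansion_intros h)
    ultimately show "(\<lambda>z. z * deriv h z) has_fps_expansion
        fps_X ^ N * (fps_X * fps_deriv H - fps_const (of_real c) * H)"
      by (rule has_fps_expansion_cong[THEN iffD2, OF _ refl])
    show "(\<lambda>z. z * deriv h z) has_fps_expansion fps_X * fps_deriv H"
      by (intro fps_expansion_intros h)
  qed
  \<comment> \<open>At order \<open>N\<close> the factor \<open>fps_X ^ N\<close> selects the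
    constant term of \<open>X (H^m)' - m c H^m\<close>, which is \<open>- m c\<close>.\<close>
  have coeff: "of_nat N * fps_nth (H ^ m) N = - (of_nat m * of_real c)" for m
    using arg_cong[OF fps_euler_power[OF ode, of m], of "\<lambda>F. fps_nth F N"]
    by (simp add: fps_X_power_mult_nth fps_power_zeroth H0) (simp add: N_def)
  note inverse_coefficient_eq[OF Sigma_star_inj_on[OF g] h H0 hg B]
  note B_eq = this(1) this(2)[of n]
  have "of_nat N * B n = of_real c"
  proof (cases "n = 0")
    case True
    then show ?thesis using coeff[of 1] B_eq(1) by (simp add: N_def)
  next
    case False
    have "of_nat n * (of_nat N * B n) = - (of_nat N * fps_nth (H ^ n) N)"
      using B_eq(2) False by (simp add: N_def algebra_simps)
    also have "\<dots> = of_nat n * of_real c" by (simp add: coeff)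
    finally show ?thesis using False by simp
  qed
  from arg_cong[OF this, of norm] have "real N * norm (B n) = \<bar>c\<bar>"
    by (simp only: norm_mult norm_of_nat norm_of_real)
  then have "norm (B n) = 2 * (1 - \<alpha>) / (real n + 1)"
    using \<alpha>(2) by (simp add: N_def c_def field_simps)
  with g B show ?thesis by blast
qed

theorem theorem3:
  fixes \<alpha> :: real
  assumes "0 \<le> \<alpha>" and "\<alpha> < 1"
  shows
    "(\<forall>g B. g \<in> Sigma_star \<alpha> \<longrightarrow> inverse_expansion g B \<longrightarrow>
        norm (B 0) \<le> 2 * (1 - \<alpha>) \<and>
        (\<forall>n k :: nat. n \<ge> 1 \<longrightarrow> k + 2 \<le> n \<longrightarrow> \<alpha> \<in> subinterval k n \<longrightarrow>
           norm (B n) \<le> Gamma (2 * real n * (1 - \<alpha>) + 1) /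
             (real n * (real n + 1) * Gamma (real n - real k) *
              Gamma (2 * real n * (1 - \<alpha>) + 1 - (real n - real k)))) \<and>
        (\<forall>n :: nat. n \<ge> 1 \<longrightarrow> \<alpha> \<in> subinterval (n - 1) n \<longrightarrow>
           norm (B n) \<le> 2 * (1 - \<alpha>) / (real n + 1))) \<and>
     (\<exists>g B. g \<in> Sigma_star \<alpha> \<and> inverse_expansion g B \<and> norm (B 0) = 2 * (1 - \<alpha>)) \<and>
     (\<forall>n :: nat. n \<ge> 1 \<longrightarrow> \<alpha> \<in> subinterval (n - 1) n \<longrightarrow>
        (\<exists>g B. g \<in> Sigma_star \<alpha> \<and> inverse_expansion g B \<and>
           norm (B n) = 2 * (1 - \<alpha>) / (real n + 1)))"
proof (intro conjI allI impI)
  fix g B assume gB: "g \<in> Sigma_star \<alpha>" "inverse_expansion g B"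
  show "norm (B 0) \<le> 2 * (1 - \<alpha>)"
    by (rule Sigma_star_inverse_coefficient_0[OF gB(1) assms(2) gB(2)])
  show "norm (B n) \<le> Gamma (2 * real n * (1 - \<alpha>) + 1) /
             (real n * (real n + 1) * Gamma (real n - real k) *
              Gamma (2 * real n * (1 - \<alpha>) + 1 - (real n - real k)))"
    if "k + 2 \<le> n" "\<alpha> \<in> subinterval k n" for n k
    by (rule Sigma_star_inverse_coefficient_Gamma_bound[OF gB(1) assms(2) gB(2) that])
  show "norm (B n) \<le> 2 * (1 - \<alpha>) / (real n + 1)"
    if "n \<ge> 1" "\<alpha> \<in> subinterval (n - 1) n" for n
    by (rule Sigma_star_inverse_coefficient_last_bound[OF gB(1) assms(2) gB(2) that])
next
  show "\<exists>g B. g \<in> Sigma_star \<alpha> \<and> inverse_expansion g B \<and> norm (B 0) = 2 * (1 - \<alpha>)"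
    using Sigma_star_inverse_coefficient_sharp[OF assms, of 0] by simp
  show "\<exists>g B. g \<in> Sigma_star \<alpha> \<and> inverse_expansion g B \<and> norm (B n) = 2 * (1 - \<alpha>) / (real n + 1)" for n
    by (rule Sigma_star_inverse_coefficient_sharp[OF assms])
qed

end
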